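(* Axioms (DMV1')–(DMV4') are equivalent with axioms (DMV1)–(DMV2); that is, (DMV1')–(DMV4') is an equivalent definition of DMV-algebras. Precisely, let $A$ be an MV-algebra. (a) If $\{r \mid r\in[0,1]_{\mathbb Q}\}$ is a family of unary operators on $A$ satisfying (DMV1')–(DMV4'), then the operators $\delta_n(x):=\frac1n x$ ($n\ge 1$) satisfy (DMV1)–(DMV2). (b) If $\{\delta_n\}_{n\ge1}$ is a family of unary operators on $A$ satisfying (DMV1)–(DMV2), then the operators $\frac mn x:=m\,\delta_n(x)$ ($0\le m\le n$, $n\ge1$) are well defined and satisfy (DMV1')–(DMV4'). (c) These two assignments are mutually inverse.
   Context: An MV-algebra is a structure $(A,\oplus,{}^*,0)$ such that $(A,\oplus,0)$ is an Abelian monoid, $(x^* )^*=x$, $(x^*\oplus y)^*\oplus y=(y^*\oplus x)^*\oplus x$ and $0^*\oplus x=0^*$. Put $1=0^*$, $x\odot y=(x^*\oplus y^* )^*$, and for an integer $m\ge0$ let $mx=x\oplus\dots\oplus x$ ($m$ times, $0x=0$). Let $[0,1]_{\mathbb Q}=[0,1]\cap\mathbb Q$, with $r\odot q^*=\max\{0,r-q\}$ and $rq$ the product of rationals. A DMV-algebra is an MV-algebra $A$ endowed with unary operators $\{\delta_n\}_{n\ge 1}$ such that for all $x\in A$ and $n\ge1$: (DMV1) $n\delta_n x=x$; (DMV2) $\delta_n x\odot (n-1)\delta_n x=0$. For an MV-algebra $A$ endowed with unary operators $\{r\mid r\in[0,1]_{\mathbb Q}\}$ consider, for all $x,y\in A$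 and $r,q\in[0,1]_{\mathbb Q}$: (DMV1') $r(x\odot y^* )=(rx)\odot(ry)^*$; (DMV2') $(r\odot q^* )x=(rx)\odot(qx)^*$; (DMV3') $r(qx)=(rq)x$; (DMV4') $1x=x$. *)

theory Defs
  imports Complex_Main
begin

locale mv_algebra = comm_monoid oplus zero
  for oplus :: "'a \<Rightarrow> 'a \<Rightarrow> 'a"  (infixl \<open>\<oplus>\<close> 65)
    and zero :: 'a  (\<open>\<zero>\<close>) +
  fixes star :: "'a \<Rightarrow> 'a"  (\<open>_\<^sup>\<star>\<close> [1000] 999)
  assumes star_star: "(x\<^sup>\<star>)\<^sup>\<star> = x"
    and lukasiewicz: "(x\<^sup>\<star> \<oplus> y)\<^sup>\<star> \<oplus> y = (y\<^sup>\<star> \<oplus> x)\<^sup>\<star> \<oplus> x"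
    and star_zero_absorb: "\<zero>\<^sup>\<star> \<oplus> x = \<zero>\<^sup>\<star>"
begin

definition odot :: "'a \<Rightarrow> 'a \<Rightarrow> 'a"  (infixl \<open>\<odot>\<close> 70)
  where "x \<odot> y = (x\<^sup>\<star> \<oplus> y\<^sup>\<star>)\<^sup>\<star>"

primrec nmul :: "nat \<Rightarrow> 'a \<Rightarrow> 'a"
  where "nmul 0 x = \<zero>"
  | "nmul (Suc m) x = x \<oplus> nmul m x"

end

text \<open>
  Families of operators are total functions of their index, but only the values
  \<open>\<delta> n\<close> for \<open>n \<ge> 1\<close> and \<open>R r\<close> for rational \<open>r\<close> with \<open>0 \<le> r \<le> 1\<close> are meaningful.
\<close>

locale dmv_algebra = mv_algebra oplus zero star
  for oplus :: "'a \<Rightarrow> 'a \<Rightarrow> 'a"  (infixl \<open>\<oplus>\<close> 65)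
    and zero :: 'a  (\<open>\<zero>\<close>)
    and star :: "'a \<Rightarrow> 'a"  (\<open>_\<^sup>\<star>\<close> [1000] 999) +
  fixes \<delta> :: "nat \<Rightarrow> 'a \<Rightarrow> 'a"
  assumes DMV1: "n \<ge> 1 \<Longrightarrow> nmul n (\<delta> n x) = x"
    and DMV2: "n \<ge> 1 \<Longrightarrow> \<delta> n x \<odot> nmul (n - 1) (\<delta> n x) = \<zero>"

text \<open>In \<open>DMV2'\<close>, \<open>max 0 (r - q)\<close> is the value of \<open>r \<odot> q\<^sup>\<star>\<close> in the rational unit interval.\<close>

locale rational_dmv_algebra = mv_algebra oplus zero star
  for oplus :: "'a \<Rightarrow> 'a \<Rightarrow> 'a"  (infixl \<open>\<oplus>\<close> 65)
    and zero :: 'a  (\<open>\<zero>\<close>)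
    and star :: "'a \<Rightarrow> 'a"  (\<open>_\<^sup>\<star>\<close> [1000] 999) +
  fixes R :: "rat \<Rightarrow> 'a \<Rightarrow> 'a"
  assumes DMV1': "r \<in> {0..1} \<Longrightarrow> R r (x \<odot> y\<^sup>\<star>) = R r x \<odot> (R r y)\<^sup>\<star>"
    and DMV2': "r \<in> {0..1} \<Longrightarrow> q \<in> {0..1} \<Longrightarrow> R (max 0 (r - q)) x = R r x \<odot> (R q x)\<^sup>\<star>"
    and DMV3': "r \<in> {0..1} \<Longrightarrow> q \<in> {0..1} \<Longrightarrow> R r (R q x) = R (r * q) x"
    and DMV4': "R 1 x = x"

definition reciprocal_ops :: "(rat \<Rightarrow> 'a \<Rightarrow> 'a) \<Rightarrow> nat \<Rightarrow> 'a \<Rightarrow> 'a"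
  where "reciprocal_ops R n x = R (1 / of_nat n) x"

text \<open>
  The description operator denotes the intended value once \<open>nmul m (\<delta> n x)\<close> is known
  to depend only on the fraction \<open>m / n\<close>.
\<close>

definition (in mv_algebra) fraction_ops :: "(nat \<Rightarrow> 'a \<Rightarrow> 'a) \<Rightarrow> rat \<Rightarrow> 'a \<Rightarrow> 'a"
  where "fraction_ops \<delta> r x =
    (THE y. \<exists>m n. n \<ge> 1 \<and> m \<le> n \<and> r = of_nat m / of_nat n \<and> y = nmul m (\<delta> n x))"

end

theory Submission
  imports Defs
begin

text \<open>
  Everything rests on one identity: if the \<open>n\<close>-fold sums of \<open>a\<close> and \<open>b\<close> involve no truncation,
  then \<open>n (a \<ominus> b) = n a \<ominus> n b\<close>. To see it, write \<open>a = c \<oplus> (a \<ominus> b)\<close> and \<open>b = c \<oplus> (b \<ominus> a)\<close> with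
  \<open>c = a \<and> b\<close>; the differences \<open>a \<ominus> b\<close> and \<open>b \<ominus> a\<close> are disjoint, hence so are their multiples, and
  \<open>n c\<close> cancels. The case \<open>n a = n b\<close> shows that \<open>\<delta>\<^sub>n x\<close> is the only untruncated \<open>n\<close>-th part of \<open>x\<close>,
  and each required equation between fractions is checked by multiplying up.
  Conversely, \<open>(DMV2')\<close> gives \<open>(k+1)/n x = 1/n x \<oplus> k/n x\<close> without truncation, so that
  \<open>k/n x = k (1/n x)\<close> by induction.
\<close>

section \<open>Truncated difference and the natural order\<close>

context mv_algebra
begin

definition diff :: "'a \<Rightarrow> 'a \<Rightarrow> 'a"  (infixl \<open>\<ominus>\<close> 65)
  where "x \<ominus> y = x \<odot> y\<^sup>\<star>"

definition le :: "'a \<Rightarrow> 'a \<Rightarrow> bool"  (infix \<open>\<sqsubseteq>\<close> 50)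
  where "x \<sqsubseteq> y \<longleftrightarrow> x \<ominus> y = \<zero>"

text \<open>In [0,1] this says x + y <= 1: the sum \<open>x \<oplus> y\<close> is the true one, with
  nothing cut off.\<close>

definition perp :: "'a \<Rightarrow> 'a \<Rightarrow> bool"  (infix \<open>\<bottom>\<^sub>+\<close> 50)
  where "x \<bottom>\<^sub>+ y \<longleftrightarrow> x \<odot> y = \<zero>"

text \<open>In [0,1] this says n a <= 1. Quantifying over all \<open>k < n\<close> lets the property
  pass to smaller \<open>n\<close> at once.\<close>

definition untruncated :: "nat \<Rightarrow> 'a \<Rightarrow> bool"
  where "untruncated n a \<longleftrightarrow> (\<forall>k<n. a \<bottom>\<^sub>+ nmul k a)"

lemma diff_eq: "x \<ominus> y = (x\<^sup>\<star> \<oplus> y)\<^sup>\<star>"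
  by (simp add: diff_def odot_def star_star)

lemma star_inject: "x\<^sup>\<star> = y\<^sup>\<star> \<longleftrightarrow> x = y"
  by (metis star_star)

lemma le_iff: "x \<sqsubseteq> y \<longleftrightarrow> x\<^sup>\<star> \<oplus> y = \<zero>\<^sup>\<star>"
  unfolding le_def diff_eq by (metis star_star)

lemma star_oplus_self: "x\<^sup>\<star> \<oplus> x = \<zero>\<^sup>\<star>"
  \<comment> \<open>At the top element, one side of the axiom reduces to
    \<open>x\<^sup>\<star> \<oplus> x\<close> and the other to the top.\<close>
  using lukasiewicz[of "\<zero>\<^sup>\<star>" x]
  by (metis commute left_neutral star_star star_zero_absorb)

lemma le_refl [simp]: "x \<sqsubseteq> x"
  by (simp add: le_iff star_oplus_self)

lemma diff_self [simp]: "x \<ominus> x = \<zero>"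
  using le_refl le_def by blast

lemma zero_le [simp]: "\<zero> \<sqsubseteq> x"
  by (simp add: le_iff star_zero_absorb)

lemma diff_zero [simp]: "x \<ominus> \<zero> = x"
  by (simp add: diff_eq star_star)

lemma diff_oplus: "x \<ominus> (y \<oplus> z) = x \<ominus> y \<ominus> z"
  by (simp add: diff_eq star_star assoc)

text \<open>The Lukasiewicz axiom at the complements; both sides are the meet of \<open>x\<close>
  and \<open>y\<close>.\<close>

lemma diff_diff_commute: "x \<ominus> (x \<ominus> y) = y \<ominus> (y \<ominus> x)"
  using lukasiewicz[of "y\<^sup>\<star>" "x\<^sup>\<star>"] by (simp add: diff_eq star_inject star_star commute)

lemma le_oplus: "x \<sqsubseteq> x \<oplus> y"
  by (simp add: le_iff assoc[symmetric] star_oplus_self star_zero_absorb)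

lemma diff_oplus_cancel: "x \<sqsubseteq> y \<Longrightarrow> (y \<ominus> x) \<oplus> x = y"
  using lukasiewicz[of x y] by (simp add: diff_eq le_iff star_star)

lemma le_iff_ex: "x \<sqsubseteq> y \<longleftrightarrow> (\<exists>t. y = x \<oplus> t)"
  by (metis commute diff_oplus_cancel le_oplus)

lemma le_trans: "x \<sqsubseteq> y \<Longrightarrow> y \<sqsubseteq> z \<Longrightarrow> x \<sqsubseteq> z"
  unfolding le_iff_ex by (metis assoc)

lemma le_antisym: "x \<sqsubseteq> y \<Longrightarrow> y \<sqsubseteq> x \<Longrightarrow> x = y"
  using diff_diff_commute[of x y] by (simp add: le_def)

lemma oplus_mono: "x \<sqsubseteq> y \<Longrightarrow> z \<oplus> x \<sqsubseteq> z \<oplus> y"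
  unfolding le_iff_ex by (metis assoc)

lemma le_zero: "x \<sqsubseteq> \<zero> \<Longrightarrow> x = \<zero>"
  by (simp add: le_def)

text \<open>Residuation: subtracting \<open>y\<close> is left adjoint to adding
  \<open>y\<close>.\<close>

lemma diff_le_iff: "x \<ominus> y \<sqsubseteq> z \<longleftrightarrow> x \<sqsubseteq> y \<oplus> z"
  by (simp add: le_def diff_oplus)

lemma diff_le: "x \<ominus> y \<sqsubseteq> x"
  by (metis commute diff_le_iff le_oplus)

lemma diff_mono: "x \<sqsubseteq> y \<Longrightarrow> x \<ominus> z \<sqsubseteq> y \<ominus> z"
  using le_trans[of x y "z \<oplus> (y \<ominus> z)"] by (simp add: diff_le_iff[symmetric])

lemma diff_antimono: "x \<sqsubseteq> y \<Longrightarrow> z \<ominus> y \<sqsubseteq> z \<ominus> x"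
  using le_trans[of z "(z \<ominus> x) \<oplus> x" "(z \<ominus> x) \<oplus> y"] oplus_mono[of x y "z \<ominus> x"]
    diff_le_iff[of z x "z \<ominus> x"] by (simp add: diff_le_iff commute)

section \<open>Sums without truncation\<close>

lemma perp_iff: "x \<bottom>\<^sub>+ y \<longleftrightarrow> x \<sqsubseteq> y\<^sup>\<star>"
  by (simp add: perp_def le_def diff_def star_star)

lemma perp_commute: "x \<bottom>\<^sub>+ y \<longleftrightarrow> y \<bottom>\<^sub>+ x"
  by (simp add: perp_def odot_def commute)

lemma perp_zero [simp]: "x \<bottom>\<^sub>+ \<zero>"
  by (simp add: perp_iff le_iff commute[of _ "\<zero>\<^sup>\<star>"] star_zero_absorb)

lemma perp_antimono: "x \<bottom>\<^sub>+ y \<Longrightarrow> x' \<sqsubseteq> x \<Longrightarrow> y' \<sqsubseteq> y \<Longrightarrow> x' \<bottom>\<^sub>+ y'"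
  using le_trans perp_commute perp_iff by metis

text \<open>By residuation it suffices that \<open>x\<close> lies below
  \<open>y \<oplus> y\<^sup>\<star>\<close>, the top element.\<close>

lemma diff_perp: "(x \<ominus> y) \<bottom>\<^sub>+ y"
  by (metis diff_le_iff perp_iff commute star_oplus_self le_iff star_star star_zero_absorb)

lemma diff_diff_cancel: "x \<sqsubseteq> y \<Longrightarrow> y \<ominus> (y \<ominus> x) = x"
  using diff_diff_commute[of x y] by (simp add: le_def)

lemma oplus_diff_cancel:
  assumes "x \<bottom>\<^sub>+ y"
  shows "(x \<oplus> y) \<ominus> y = x"
proof -
  \<comment> \<open>The right side is the meet of \<open>y\<^sup>\<star>\<close> and
    \<open>x\<close>, which is \<open>x\<close> as soon as \<open>x\<close> lies below
    \<open>y\<^sup>\<star>\<close>.\<close>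
  have "(x \<oplus> y) \<ominus> y = y\<^sup>\<star> \<ominus> (y\<^sup>\<star> \<ominus> x)"
    by (simp add: diff_eq star_star commute)
  then show ?thesis
    using assms by (simp add: perp_iff diff_diff_cancel)
qed

text \<open>Associativity of the partial addition: subtract \<open>y\<close> from
  \<open>x \<oplus> y \<sqsubseteq> z\<^sup>\<star>\<close> and read
  \<open>z\<^sup>\<star> \<ominus> y\<close> as the complement of
  \<open>y \<oplus> z\<close>.\<close>

lemma perp_assoc:
  assumes "x \<bottom>\<^sub>+ y" "(x \<oplus> y) \<bottom>\<^sub>+ z"
  shows "x \<bottom>\<^sub>+ (y \<oplus> z)"
proof -
  have "x \<sqsubseteq> z\<^sup>\<star> \<ominus> y"
    using diff_mono[of "x \<oplus> y" "z\<^sup>\<star>" y] assms by (simp add: perp_iff[of "x \<oplus> y"] oplus_diff_cancel)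
  then show ?thesis
    by (simp add: perp_iff diff_eq star_star commute)
qed

lemma perp_interchange:
  assumes "p \<bottom>\<^sub>+ q" "r \<bottom>\<^sub>+ s" "(p \<oplus> q) \<bottom>\<^sub>+ (r \<oplus> s)"
  shows "(p \<oplus> r) \<bottom>\<^sub>+ (q \<oplus> s)"
proof -
  have "q \<sqsubseteq> p \<oplus> q"
    by (metis commute le_oplus)
  then have "(r \<oplus> s) \<bottom>\<^sub>+ q"
    using assms(3) perp_antimono le_refl perp_commute by blast
  then have 1: "r \<bottom>\<^sub>+ (q \<oplus> s)"
    using perp_assoc[OF assms(2)] by (simp add: commute)
  have "p \<bottom>\<^sub>+ (q \<oplus> (r \<oplus> s))"
    using perp_assoc assms(1,3) by blast
  then have 2: "(q \<oplus> s) \<oplus> r \<bottom>\<^sub>+ p"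
    by (simp add: perp_commute ac_simps)
  from 1 have "(q \<oplus> s) \<bottom>\<^sub>+ r"
    by (simp add: perp_commute)
  from perp_assoc[OF this 2] show ?thesis
    by (simp add: perp_commute commute)
qed

section \<open>Meets and disjoint elements\<close>

lemma meet_greatest:
  assumes "z \<sqsubseteq> x" "z \<sqsubseteq> y"
  shows "z \<sqsubseteq> x \<ominus> (x \<ominus> y)"
proof -
  have "x \<ominus> (x \<ominus> z) \<sqsubseteq> x \<ominus> (x \<ominus> y)"
    by (intro diff_antimono assms(2))
  then show ?thesis
    by (simp add: diff_diff_cancel assms(1))
qed

lemma diff_meet: "x \<ominus> (x \<ominus> (x \<ominus> y)) = x \<ominus> y"
  by (rule diff_diff_cancel[OF diff_le])

text \<open>Turns a vanishing meet into an equation that survives repeated subtraction, as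
  \<open>disjoint_nmul\<close> needs.\<close>

lemma disjoint_iff: "x \<ominus> (x \<ominus> y) = \<zero> \<longleftrightarrow> x \<ominus> y = x"
  by (metis diff_meet diff_self diff_zero)

lemma disjoint_commute: "x \<ominus> y = x \<longleftrightarrow> y \<ominus> x = y"
  by (metis diff_diff_commute disjoint_iff)

lemma disjoint_nmul: "x \<ominus> y = x \<Longrightarrow> x \<ominus> nmul n y = x"
  by (induction n) (auto simp: diff_oplus)

lemma diff_disjoint_diff: "(a \<ominus> b) \<ominus> (b \<ominus> a) = a \<ominus> b"
proof -
  define c where "c = a \<ominus> (a \<ominus> b)"
  have c: "a \<ominus> b = a \<ominus> c" "b \<ominus> a = b \<ominus> c" "c \<sqsubseteq> a" "c \<sqsubseteq> b"
    unfolding c_def using diff_meet diff_diff_commute diff_le by metis+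
  \<comment> \<open>The meet \<open>d\<close> of the two differences, stacked on \<open>c\<close>,
    stays below both \<open>a\<close> and \<open>b\<close>, hence below their meet \<open>c\<close>;
    cancelling \<open>c\<close> leaves \<open>d = \<zero>\<close>.\<close>
  define d where "d = (a \<ominus> b) \<ominus> ((a \<ominus> b) \<ominus> (b \<ominus> a))"
  have d: "d \<sqsubseteq> a \<ominus> c" "d \<sqsubseteq> b \<ominus> c"
    unfolding d_def c(1,2)[symmetric] using diff_diff_commute diff_le by metis+
  have "d \<oplus> c \<sqsubseteq> a" "d \<oplus> c \<sqsubseteq> b"
    using d c(3,4) oplus_mono diff_oplus_cancel commute by metis+
  then have "d \<oplus> c \<sqsubseteq> c"
    unfolding c_def by (rule meet_greatest)
  moreover have "d \<bottom>\<^sub>+ c"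
    using d(1) diff_perp perp_antimono le_refl by blast
  ultimately have "d = \<zero>"
    using oplus_diff_cancel by (simp add: le_def)
  then show ?thesis
    by (simp add: d_def disjoint_iff)
qed

section \<open>Multiples without truncation\<close>

lemma nmul_add: "nmul (m + n) x = nmul m x \<oplus> nmul n x"
  by (induction m) (auto simp: assoc)

lemma nmul_oplus: "nmul n (x \<oplus> y) = nmul n x \<oplus> nmul n y"
  by (induction n) (auto simp: ac_simps)

lemma nmul_mult: "nmul (m * n) x = nmul m (nmul n x)"
  by (induction m) (auto simp: nmul_add)

lemma nmul_mono: "x \<sqsubseteq> y \<Longrightarrow> nmul n x \<sqsubseteq> nmul n y"
  unfolding le_iff_ex by (metis nmul_oplus)

lemma nmul_le_nmul: "m \<le> n \<Longrightarrow> nmul m x \<sqsubseteq> nmul n x"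
  by (metis le_Suc_ex nmul_add le_oplus)

lemma le_nmul: "n \<ge> 1 \<Longrightarrow> x \<sqsubseteq> nmul n x"
  using nmul_le_nmul[of 1 n x] by simp

lemma untruncated_le: "untruncated n a \<Longrightarrow> m \<le> n \<Longrightarrow> untruncated m a"
  by (auto simp: untruncated_def)

lemma untruncated_antimono: "untruncated n a \<Longrightarrow> b \<sqsubseteq> a \<Longrightarrow> untruncated n b"
  using perp_antimono nmul_mono unfolding untruncated_def by blast

text \<open>Induction trades the pair \<open>Suc k\<close>, \<open>l\<close> for \<open>k\<close>,
  \<open>Suc l\<close>; \<open>perp_assoc\<close> then moves the extra copy of \<open>a\<close>
  back.\<close>

lemma untruncated_perp: "untruncated n a \<Longrightarrow> k + l \<le> n \<Longrightarrow> nmul k a \<bottom>\<^sub>+ nmul l a"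
proof (induction k arbitrary: l)
  case 0
  then show ?case by (simp add: perp_commute[of \<zero>])
next
  case (Suc k)
  have 1: "nmul k a \<bottom>\<^sub>+ nmul (Suc l) a"
    using Suc.IH[of "Suc l"] Suc.prems by (simp del: nmul.simps)
  have "nmul l a \<bottom>\<^sub>+ a"
    using Suc.prems by (simp add: untruncated_def perp_commute)
  moreover have "nmul l a \<oplus> a \<bottom>\<^sub>+ nmul k a"
    using 1 by (simp add: perp_commute commute)
  ultimately show ?case
    using perp_assoc by (metis nmul.simps(2) perp_commute)
qed

text \<open>Links the notion to the single condition in \<open>DMV2\<close>: the smaller multiples
  all lie below the last one.\<close>

lemma untruncated_iff:
  assumes "n \<ge> 1"
  shows "untruncated n a \<longleftrightarrow> a \<bottom>\<^sub>+ nmul (n - 1) a"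
proof
  assume "a \<bottom>\<^sub>+ nmul (n - 1) a"
  moreover have "nmul k a \<sqsubseteq> nmul (n - 1) a" if "k < n" for k
    using that by (intro nmul_le_nmul) simp
  ultimately show "untruncated n a"
    using perp_antimono le_refl unfolding untruncated_def by blast
qed (use assms in \<open>simp add: untruncated_def\<close>)

lemma untruncated_nmul:
  assumes "untruncated (n * k) a"
  shows "untruncated n (nmul k a)"
  unfolding untruncated_def
proof (intro allI impI)
  fix j assume "j < n"
  then have "k + j * k \<le> n * k"
    by (metis Suc_leI mult_Suc mult_le_mono1)
  then show "nmul k a \<bottom>\<^sub>+ nmul j (nmul k a)"
    using untruncated_perp[OF assms] by (simp add: nmul_mult[symmetric])
qed

lemma untruncated_nmul_diff:
  assumes "untruncated n a" "k \<le> n"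
  shows "nmul k a \<ominus> nmul l a = nmul (k - l) a"
proof (cases "l \<le> k")
  case True
  then show ?thesis
    using oplus_diff_cancel[OF untruncated_perp[OF assms(1), of "k - l" l]] assms(2)
    by (simp add: nmul_add[symmetric])
next
  case False
  \<comment> \<open>For \<open>k < l\<close> the subtraction of naturals gives 0, matching the
    truncated difference.\<close>
  then show ?thesis
    using nmul_le_nmul[of k l a] by (simp add: le_def)
qed

lemma untruncated_oplus_perp:
  assumes "p \<bottom>\<^sub>+ q" "untruncated n (p \<oplus> q)"
  shows "nmul n p \<bottom>\<^sub>+ nmul n q"
  using assms(2)
proof (induction n)
  case (Suc n)
  then have "nmul n p \<bottom>\<^sub>+ nmul n q" "(p \<oplus> q) \<bottom>\<^sub>+ (nmul n p \<oplus> nmul n q)"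
    by (auto simp: untruncated_le untruncated_def nmul_oplus[symmetric])
  \<comment> \<open>The four summands \<open>p\<close>, \<open>q\<close>, \<open>nmul n p\<close>,
    \<open>nmul n q\<close> are regrouped by letter.\<close>
  then show ?case
    using perp_interchange[OF assms(1)] by simp
qed simp

lemma nmul_diff:
  assumes "untruncated n a"
  shows "nmul n (a \<ominus> b) = nmul n a \<ominus> nmul n b"
proof -
  define c where "c = a \<ominus> (a \<ominus> b)"
  have a: "(a \<ominus> b) \<oplus> c = a"
    unfolding c_def by (metis commute diff_oplus_cancel diff_le)
  have b: "c \<oplus> (b \<ominus> a) = b"
    unfolding c_def diff_diff_commute[of a b] by (rule diff_oplus_cancel[OF diff_le])
  have "(a \<ominus> b) \<bottom>\<^sub>+ c"
    unfolding c_def using diff_perp perp_commute by blast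
  then have "nmul n (a \<ominus> b) \<bottom>\<^sub>+ nmul n c"
    by (rule untruncated_oplus_perp) (simp add: a assms)
  then have "nmul n a \<ominus> nmul n c = nmul n (a \<ominus> b)"
    using oplus_diff_cancel nmul_oplus a by metis
  \<comment> \<open>Disjointness passes to multiples one argument at a time, with a swap in
    between.\<close>
  moreover have "nmul n (a \<ominus> b) \<ominus> nmul n (b \<ominus> a) = nmul n (a \<ominus> b)"
    using diff_disjoint_diff disjoint_nmul disjoint_commute by metis
  \<comment> \<open>Subtracting \<open>nmul n b\<close> means subtracting \<open>nmul n c\<close>,
    which leaves \<open>nmul n (a \<ominus> b)\<close>, and then
    \<open>nmul n (b \<ominus> a)\<close>, which removes nothing.\<close>
  ultimately show ?thesis
    using nmul_oplus[of n c "b \<ominus> a"] b by (simp add: diff_oplus)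
qed

lemma untruncated_nmul_inject:
  assumes "n \<ge> 1" "untruncated n a" "untruncated n b" "nmul n a = nmul n b"
  shows "a = b"
proof (rule le_antisym)
  show "a \<sqsubseteq> b"
    \<comment> \<open>\<open>a \<ominus> b\<close> lies below its own \<open>n\<close>-fold
      multiple, which is \<open>nmul n a \<ominus> nmul n b\<close>, hence zero.\<close>
    using nmul_diff[OF assms(2), of b] le_nmul[OF assms(1), of "a \<ominus> b"] assms(4)
    by (simp add: le_zero le_def[of a])
  show "b \<sqsubseteq> a"
    using nmul_diff[OF assms(3), of a] le_nmul[OF assms(1), of "b \<ominus> a"] assms(4)
    by (simp add: le_zero le_def[of b])
qed

end

section \<open>Division operators and fractions of an element\<close>

context dmv_algebra
begin

lemma untruncated_\<delta>: "n \<ge> 1 \<Longrightarrow> untruncated n (\<delta> n x)"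
  using DMV2 by (simp add: untruncated_iff perp_def)

lemma \<delta>_eqI: "n \<ge> 1 \<Longrightarrow> untruncated n a \<Longrightarrow> nmul n a = x \<Longrightarrow> \<delta> n x = a"
  by (rule untruncated_nmul_inject[of n]) (simp_all add: untruncated_\<delta> DMV1)

lemma \<delta>_diff: "n \<ge> 1 \<Longrightarrow> \<delta> n (x \<ominus> y) = \<delta> n x \<ominus> \<delta> n y"
  by (rule \<delta>_eqI) (auto simp: nmul_diff untruncated_\<delta> DMV1 intro: untruncated_antimono[OF _ diff_le])

lemma nmul_\<delta>_mult: "n \<ge> 1 \<Longrightarrow> k \<ge> 1 \<Longrightarrow> nmul k (\<delta> (n * k) x) = \<delta> n x"
  by (rule \<delta>_eqI[symmetric]) (auto simp: untruncated_nmul untruncated_\<delta> nmul_mult[symmetric] DMV1)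

text \<open>The product of 1/n and m/k, from which \<open>DMV3'\<close> follows.\<close>

lemma \<delta>_nmul:
  assumes "n \<ge> 1" "k \<ge> 1" "m \<le> k"
  shows "\<delta> n (nmul m (\<delta> k x)) = nmul m (\<delta> (k * n) x)"
proof (rule \<delta>_eqI[OF assms(1)])
  have "untruncated (n * m) (\<delta> (k * n) x)"
    by (rule untruncated_le[OF untruncated_\<delta>]) (use assms in auto)
  then show "untruncated n (nmul m (\<delta> (k * n) x))"
    by (rule untruncated_nmul)
  show "nmul n (nmul m (\<delta> (k * n) x)) = nmul m (\<delta> k x)"
    using assms(1,2) by (metis mult.commute nmul_\<delta>_mult nmul_mult)
qed

text \<open>After cross-multiplication both sides are the same multiple of
  \<open>\<delta> (n * n') x\<close>.\<close>

lemma nmul_\<delta>_cong: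
  assumes "n \<ge> 1" "n' \<ge> 1" "(of_nat m / of_nat n :: rat) = of_nat m' / of_nat n'"
  shows "nmul m (\<delta> n x) = nmul m' (\<delta> n' x)"
proof -
  have "(of_nat (m * n') :: rat) = of_nat (m' * n)"
    using assms by (simp add: field_simps)
  then have "m * n' = m' * n"
    using of_nat_eq_iff by blast
  then show ?thesis
    using nmul_\<delta>_mult[of n n' x] nmul_\<delta>_mult[of n' n x] assms(1,2)
    by (metis mult.commute nmul_mult)
qed

lemma fraction_ops_eq:
  assumes "n \<ge> 1" "m \<le> n"
  shows "fraction_ops \<delta> (of_nat m / of_nat n) x = nmul m (\<delta> n x)"
  unfolding fraction_ops_def
proof (rule the_equality)
  show "\<exists>m' n'. n' \<ge> 1 \<and> m' \<le> n' \<and> (of_nat m / of_nat n :: rat) = of_nat m' / of_nat n'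
      \<and> nmul m (\<delta> n x) = nmul m' (\<delta> n' x)"
    using assms by blast
qed (use assms(1) in \<open>auto intro: nmul_\<delta>_cong\<close>)

end

section \<open>Rationals of the unit interval as fractions\<close>

lemma unit_rat_fraction:
  fixes r :: rat
  assumes "r \<in> {0..1}"
  obtains m n where "n \<ge> 1" "m \<le> n" "r = of_nat m / of_nat n"
proof -
  obtain a b where ab: "r = of_int a / of_int b" "b > 0"
    by (metis quotient_of_denom_pos quotient_of_div surj_pair)
  have "0 \<le> a" "a \<le> b"
    using assms ab by (auto simp: field_simps zero_le_mult_iff zero_le_divide_iff)
  then have "nat b \<ge> 1" "nat a \<le> nat b" "r = of_nat (nat a) / of_nat (nat b)"
    using ab by auto
  then show thesis ..
qed

lemma unit_rat_common_fraction:
  fixes r q :: rat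
  assumes "r \<in> {0..1}" "q \<in> {0..1}"
  obtains m k n where "n \<ge> 1" "m \<le> n" "k \<le> n" "r = of_nat m / of_nat n" "q = of_nat k / of_nat n"
proof -
  obtain m n where 1: "n \<ge> 1" "m \<le> n" "r = of_nat m / of_nat n"
    using unit_rat_fraction assms(1) .
  obtain k l where 2: "l \<ge> 1" "k \<le> l" "q = of_nat k / of_nat l"
    using unit_rat_fraction assms(2) .
  have "n * l \<ge> 1" "m * l \<le> n * l" "k * n \<le> n * l"
    "r = of_nat (m * l) / of_nat (n * l)" "q = of_nat (k * n) / of_nat (n * l)"
    using 1 2 by auto
  then show thesis ..
qed

section \<open>From division operators to rational operators\<close>

lemma (in dmv_algebra) rational_dmv_fraction_ops:
  "rational_dmv_algebra oplus zero star (fraction_ops \<delta>)"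
proof unfold_locales
  fix r :: rat and x y assume "r \<in> {0..1}"
  then obtain m n where *: "n \<ge> 1" "m \<le> n" "r = of_nat m / of_nat n"
    by (rule unit_rat_fraction)
  show "fraction_ops \<delta> r (x \<odot> y\<^sup>\<star>) = fraction_ops \<delta> r x \<odot> (fraction_ops \<delta> r y)\<^sup>\<star>"
    using * nmul_diff[OF untruncated_le[OF untruncated_\<delta>], of n m x]
    by (simp add: fraction_ops_eq diff_def[symmetric] \<delta>_diff)
next
  fix r q :: rat and x assume "r \<in> {0..1}" "q \<in> {0..1}"
  then obtain m k n where *: "n \<ge> 1" "m \<le> n" "k \<le> n" "r = of_nat m / of_nat n" "q = of_nat k / of_nat n"
    by (rule unit_rat_common_fraction)
  \<comment> \<open>Over a common denominator, truncated subtraction of rationals is that of the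
    numerators.\<close>
  have "max 0 (r - q) = of_nat (m - k) / of_nat n"
    unfolding *(4,5) diff_divide_distrib[symmetric] using *(1)
    by (cases "k \<le> m") (auto simp: max_def of_nat_diff field_simps)
  then show "fraction_ops \<delta> (max 0 (r - q)) x = fraction_ops \<delta> r x \<odot> (fraction_ops \<delta> q x)\<^sup>\<star>"
    using * untruncated_nmul_diff[OF untruncated_\<delta>, of n m x k]
    by (simp add: fraction_ops_eq diff_def[symmetric])
next
  fix r q :: rat and x assume "r \<in> {0..1}" "q \<in> {0..1}"
  obtain m n where 1: "n \<ge> 1" "m \<le> n" "r = of_nat m / of_nat n"
    using unit_rat_fraction \<open>r \<in> {0..1}\<close> .
  obtain k l where 2: "l \<ge> 1" "k \<le> l" "q = of_nat k / of_nat l"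
    using unit_rat_fraction \<open>q \<in> {0..1}\<close> .
  \<comment> \<open>The denominator is written \<open>l * n\<close> to fit
    \<open>\<delta>_nmul\<close>, where the inner division is by \<open>l\<close>.\<close>
  have "fraction_ops \<delta> (r * q) x = nmul (m * k) (\<delta> (l * n) x)"
    using 1 2 fraction_ops_eq[of "l * n" "m * k" x] mult_le_mono[OF 1(2) 2(2)]
    by (simp add: mult.commute)
  then show "fraction_ops \<delta> r (fraction_ops \<delta> q x) = fraction_ops \<delta> (r * q) x"
    using 1 2 by (simp add: fraction_ops_eq \<delta>_nmul nmul_mult)
next
  fix x
  show "fraction_ops \<delta> 1 x = x"
    using fraction_ops_eq[of 1 1 x] DMV1[of 1 x] by simp
qed

section \<open>From rational operators to division operators\<close>

context rational_dmv_algebra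
begin

lemma R_zero: "R 0 x = \<zero>"
  using DMV2'[of 1 1 x] by (simp add: diff_def[symmetric])

lemma R_mono:
  assumes "r \<in> {0..1}" "q \<in> {0..1}" "q \<le> r"
  shows "R q x \<sqsubseteq> R r x"
  \<comment> \<open>As \<open>q \<le> r\<close>, the truncated value of \<open>q - r\<close> is 0,
    so the difference of the images is \<open>R 0 x\<close>.\<close>
  using DMV2'[of q r x] assms R_zero[of x] by (simp add: le_def diff_def max_def split: if_splits)

lemma R_fraction_Suc:
  assumes "Suc k \<le> n"
  shows "R (of_nat (Suc k) / of_nat n) x = R (1 / of_nat n) x \<oplus> R (of_nat k / of_nat n) x"
    and "R (1 / of_nat n) x \<bottom>\<^sub>+ R (of_nat k / of_nat n) x"
proof -
  define r :: rat where "r = of_nat (Suc k) / of_nat n"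
  define q :: rat where "q = 1 / of_nat n"
  have rq: "r \<in> {0..1}" "q \<in> {0..1}" "q \<le> r"
    using assms by (auto simp: r_def q_def field_simps)
  have "max 0 (r - q) = of_nat k / of_nat n"
    using assms by (simp add: r_def q_def field_simps)
  \<comment> \<open>Both claims are now facts about a difference: adding back what was subtracted
    restores \<open>R r x\<close>, and this sum is untruncated.\<close>
  then have k: "R (of_nat k / of_nat n) x = R r x \<ominus> R q x"
    using DMV2'[OF rq(1,2)] by (simp add: diff_def)
  show "R (of_nat (Suc k) / of_nat n) x = R (1 / of_nat n) x \<oplus> R (of_nat k / of_nat n) x"
    unfolding k r_def[symmetric] q_def[symmetric]
    using diff_oplus_cancel[OF R_mono[OF rq]] by (simp add: commute)
  show "R (1 / of_nat n) x \<bottom>\<^sub>+ R (of_nat k / of_nat n) x"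
    unfolding k q_def[symmetric] using diff_perp perp_commute by blast
qed

lemma R_fraction: "k \<le> n \<Longrightarrow> R (of_nat k / of_nat n) x = nmul k (R (1 / of_nat n) x)"
proof (induction k)
  case 0
  then show ?case by (simp add: R_zero)
next
  case (Suc k)
  then show ?case using R_fraction_Suc(1)[of k n x] by simp
qed

lemma dmv_reciprocal_ops: "dmv_algebra oplus zero star (reciprocal_ops R)"
proof unfold_locales
  fix n :: nat and x assume n: "n \<ge> 1"
  show "nmul n (reciprocal_ops R n x) = x"
    \<comment> \<open>At \<open>k = n\<close> the fraction is 1, and \<open>DMV4'\<close>
      applies.\<close>
    using R_fraction[of n n x] n DMV4' by (simp add: reciprocal_ops_def)
  show "reciprocal_ops R n x \<odot> nmul (n - 1) (reciprocal_ops R n x) = \<zero>"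
    \<comment> \<open>At \<open>k = n - 1\<close> the untruncated sum of
      \<open>R_fraction_Suc\<close> is exactly \<open>DMV2\<close>.\<close>
    using R_fraction[of "n - 1" n x] R_fraction_Suc(2)[of "n - 1" n x] n
    by (simp add: reciprocal_ops_def perp_def)
qed

lemma fraction_ops_reciprocal_ops:
  assumes "r \<in> {0..1}"
  shows "fraction_ops (reciprocal_ops R) r = R r"
proof
  fix x
  interpret D: dmv_algebra oplus zero star "reciprocal_ops R"
    by (rule dmv_reciprocal_ops)
  obtain m n where "n \<ge> 1" "m \<le> n" "r = of_nat m / of_nat n"
    using unit_rat_fraction assms .
  then show "fraction_ops (reciprocal_ops R) r x = R r x"
    by (simp add: D.fraction_ops_eq R_fraction reciprocal_ops_def)
qed

end

lemma (in dmv_algebra) reciprocal_ops_fraction_ops: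
  "n \<ge> 1 \<Longrightarrow> reciprocal_ops (fraction_ops \<delta>) n = \<delta> n"
  using fraction_ops_eq[of n 1] by (auto simp: reciprocal_ops_def)

theorem corollary2p1:
  fixes oplus :: "'a \<Rightarrow> 'a \<Rightarrow> 'a" and zero :: 'a and star :: "'a \<Rightarrow> 'a"
  assumes "mv_algebra oplus zero star"
  shows
    "(\<forall>R :: rat \<Rightarrow> 'a \<Rightarrow> 'a. rational_dmv_algebra oplus zero star R \<longrightarrow>
        dmv_algebra oplus zero star (reciprocal_ops R))
     \<and>
     (\<forall>\<delta> :: nat \<Rightarrow> 'a \<Rightarrow> 'a. dmv_algebra oplus zero star \<delta> \<longrightarrow>
        (\<forall>m n m' n' x. n \<ge> 1 \<and> m \<le> n \<and> n' \<ge> 1 \<and> m' \<le> n' \<and>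
            (of_nat m / of_nat n :: rat) = of_nat m' / of_nat n' \<longrightarrow>
            mv_algebra.nmul oplus zero m (\<delta> n x) = mv_algebra.nmul oplus zero m' (\<delta> n' x)) \<and>
        (\<forall>m n x. n \<ge> 1 \<and> m \<le> n \<longrightarrow>
            mv_algebra.fraction_ops oplus zero \<delta> (of_nat m / of_nat n) x =
              mv_algebra.nmul oplus zero m (\<delta> n x)) \<and>
        rational_dmv_algebra oplus zero star (mv_algebra.fraction_ops oplus zero \<delta>))
     \<and>
     (\<forall>R :: rat \<Rightarrow> 'a \<Rightarrow> 'a. rational_dmv_algebra oplus zero star R \<longrightarrow>
        (\<forall>r\<in>{0..1}. mv_algebra.fraction_ops oplus zero (reciprocal_ops R) r = R r))
     \<and>
     (\<forall>\<delta> :: nat \<Rightarrow> 'a \<Rightarrow> 'a. dmv_algebra oplus zero star \<delta> \<longrightarrow>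
        (\<forall>n\<ge>1. reciprocal_ops (mv_algebra.fraction_ops oplus zero \<delta>) n = \<delta> n))"
proof (intro conjI allI impI ballI)
  fix R :: "rat \<Rightarrow> 'a \<Rightarrow> 'a" and r :: rat
  assume "rational_dmv_algebra oplus zero star R"
  then interpret rational_dmv_algebra oplus zero star R .
  show "dmv_algebra oplus zero star (reciprocal_ops R)"
    by (rule dmv_reciprocal_ops)
  show "fraction_ops (reciprocal_ops R) r = R r" if "r \<in> {0..1}"
    using that by (rule fraction_ops_reciprocal_ops)
next
  fix \<delta> :: "nat \<Rightarrow> 'a \<Rightarrow> 'a" and m n m' n' :: nat and x
  assume "dmv_algebra oplus zero star \<delta>"
  then interpret dmv_algebra oplus zero star \<delta> .
  show "nmul m (\<delta> n x) = nmul m' (\<delta> n' x)"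
    if "n \<ge> 1 \<and> m \<le> n \<and> n' \<ge> 1 \<and> m' \<le> n' \<and> (of_nat m / of_nat n :: rat) = of_nat m' / of_nat n'"
    using that by (intro nmul_\<delta>_cong) auto
  show "fraction_ops \<delta> (of_nat m / of_nat n) x = nmul m (\<delta> n x)" if "n \<ge> 1 \<and> m \<le> n"
    using that by (intro fraction_ops_eq) auto
  show "rational_dmv_algebra oplus zero star (fraction_ops \<delta>)"
    by (rule rational_dmv_fraction_ops)
  show "reciprocal_ops (fraction_ops \<delta>) n = \<delta> n" if "n \<ge> 1"
    using that by (rule reciprocal_ops_fraction_ops)
qed

end
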